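(* Let $q$ be a prime power and $n\ge 2$. Let $L$ be an $\mathbb{F}_q$-linear set of rank $n$ in $\mathrm{PG}(1,q^n)$ admitting a point $P$ of weight $t$ and a point $Q\neq P$ of weight $s$ with $t+s=n$. Then $L$ is $\mathrm{PGL}(2,q^n)$-equivalent to the $\mathbb{F}_q$-linear set \[L_{p_{T,S}}=\{\langle (x,p_{T,S}(x))\rangle_{\mathbb{F}_{q^n}} \colon x\in\mathbb{F}_{q^n}^*\},\] where $T$ and $S$ are $\mathbb{F}_q$-subspaces of $\mathbb{F}_{q^n}$ of dimension $t$ and $s$ respectively such that $\mathbb{F}_{q^n}=T\oplus S$, and $p_{T,S}$ is the projection map of $\mathbb{F}_{q^n}$ from $T$ onto $S$. Moreover, if $T=\langle \xi_0,\dots,\xi_{t-1}\rangle_{\mathbb{F}_q}$, $S=\langle \xi_t,\dots,\xi_{n-1}\rangle_{\mathbb{F}_q}$ and $(\xi_0^*,\dots,\xi_{n-1}^* )$ is the dual basis of $(\xi_0,\dots,\xi_{n-1})$, then \[p_{T,S}(x)=\sum_{i=t}^{n-1}\xi_i\,\mathrm{Tr}_{q^n/q}(\xi_i^*x)=\sum_{j=0}^{n-1}\Big(\sum_{i=t}^{n-1}\xi_i\,\xi_i^{*q^j}\Big)x^{q^j}.\]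
   Context: For an $\mathbb{F}_q$-subspace $U$ of $V=\mathbb{F}_{q^n}^2$, the $\mathbb{F}_q$-linear set $L_U=\{\langle \mathbf u\rangle_{\mathbb{F}_{q^n}}\colon \mathbf u\in U\setminus\{\mathbf 0\}\}\subseteq \mathrm{PG}(1,q^n)$ has rank $\dim_{\mathbb{F}_q}U$. The weight of a point $\langle\mathbf v\rangle_{\mathbb{F}_{q^n}}$ in $L_U$ is $\dim_{\mathbb{F}_q}(U\cap\langle\mathbf v\rangle_{\mathbb{F}_{q^n}})$; an $\mathbb{F}_q$-linear set $L$ is a set of this form and the weight of a point is computed with respect to the underlying subspace. For a $q$-polynomial $f$, $L_f=\{\langle (x,f(x))\rangle_{\mathbb{F}_{q^n}}\colon x\in\mathbb{F}_{q^n}^*\}$. If $\mathbb{F}_{q^n}=T\oplus S$, the projection from $T$ onto $S$ is the map sending $x=u+v$ ($u\in S$, $v\in T$) to $u$. Two ordered $\mathbb{F}_q$-bases $(\xi_i)$ and $(\xi_i^* )$ of $\mathbb{F}_{q^n}$ are dual if $\mathrm{Tr}_{q^n/q}(\xi_i\xi_j^* )=\delta_{ij}$, where $\mathrm{Tr}_{q^n/q}(a)=\sum_{i=0}^{n-1}a^{q^i}$. *)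

theory Defs
  imports "HOL-Analysis.Analysis"
begin

text \<open>
  The extension of the field with \<open>q\<close> elements by the field with \<open>q^n\<close> elements is given by
  two finite field types \<open>'k\<close> (\<open>q = CARD('k)\<close>) and \<open>'a\<close> (\<open>CARD('a) = q^n\<close>) and an embedding
  \<open>emb :: 'k \<Rightarrow> 'a\<close>. Every \<open>'a\<close>-vector space then becomes a \<open>'k\<close>-vector space by restriction
  of scalars. The two spaces needed are \<open>'a\<close> itself and the plane \<open>'a^2\<close>.
\<close>

definition field_embedding :: "('k::field \<Rightarrow> 'a::field) \<Rightarrow> bool" where
  "field_embedding emb \<longleftrightarrow> emb 1 = 1 \<and>
     (\<forall>x y. emb (x + y) = emb x + emb y) \<and> (\<forall>x y. emb (x * y) = emb x * emb y)"

abbreviation scale_F :: "('k::field \<Rightarrow> 'a::field) \<Rightarrow> 'k \<Rightarrow> 'a \<Rightarrow> 'a" where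
  "scale_F emb \<equiv> (\<lambda>c x. emb c * x)"

abbreviation scale_V :: "('k::field \<Rightarrow> 'a::field) \<Rightarrow> 'k \<Rightarrow> 'a^2 \<Rightarrow> 'a^2" where
  "scale_V emb \<equiv> (\<lambda>c v. emb c *s v)"

lemma vector_space_scale_F: "field_embedding emb \<Longrightarrow> vector_space (scale_F emb)"
  by unfold_locales (auto simp: field_embedding_def algebra_simps)

lemma vector_space_scale_V: "field_embedding emb \<Longrightarrow> vector_space (scale_V emb)"
  by unfold_locales
    (auto simp: field_embedding_def vector_add_ldistrib vector_sadd_rdistrib vector_smult_assoc)

text \<open>Points of \<open>PG(1,q^n)\<close> are the one-dimensional \<open>'a\<close>-subspaces of \<open>'a^2\<close>, as sets of vectors.\<close>

definition pg_points :: "('a::field^2) set set" where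
  "pg_points = {vec.span {v} | v. v \<noteq> 0}"

definition linear_set :: "('a::field^2) set \<Rightarrow> ('a^2) set set" where
  "linear_set U = {vec.span {u} | u. u \<in> U \<and> u \<noteq> 0}"

definition weight :: "('k::field \<Rightarrow> 'a::field) \<Rightarrow> ('a^2) set \<Rightarrow> ('a^2) set \<Rightarrow> nat" where
  "weight emb U P = vector_space.dim (scale_V emb) (U \<inter> P)"

definition linear_set_of_map :: "('a::field \<Rightarrow> 'a) \<Rightarrow> ('a^2) set set" where
  "linear_set_of_map f = {vec.span {vector [x, f x]} | x. x \<noteq> 0}"

text \<open>
  An element of \<open>PGL(2,q^n)\<close> is represented by an invertible matrix; proportional matrices
  act in the same way on points.
\<close>

definition projectivity :: "'a::field^2^2 \<Rightarrow> ('a^2) set \<Rightarrow> ('a^2) set" where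
  "projectivity A P = (\<lambda>v. A *v v) ` P"

definition pgl_equivalent :: "('a::field^2) set set \<Rightarrow> ('a^2) set set \<Rightarrow> bool" where
  "pgl_equivalent L L' \<longleftrightarrow> (\<exists>A. invertible A \<and> projectivity A ` L = L')"

definition direct_sum_decomposition ::
  "('k::field \<Rightarrow> 'a::field) \<Rightarrow> 'a set \<Rightarrow> 'a set \<Rightarrow> bool" where
  "direct_sum_decomposition emb T S \<longleftrightarrow>
     module.subspace (scale_F emb) T \<and> module.subspace (scale_F emb) S \<and>
     T \<inter> S = {0} \<and> {v + u | v u. v \<in> T \<and> u \<in> S} = UNIV"

text \<open>
  The projection from \<open>T\<close> onto \<open>S\<close> has kernel \<open>T\<close> and image \<open>S\<close>. It is only meaningful if the
  ambient field is the direct sum of \<open>T\<close> and \<open>S\<close>.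
\<close>

definition projection :: "'a::field set \<Rightarrow> 'a set \<Rightarrow> 'a \<Rightarrow> 'a" where
  "projection T S x = (THE u. u \<in> S \<and> (\<exists>v\<in>T. x = u + v))"

text \<open>The trace takes values in the subfield, but is regarded as an element of the large field.\<close>

definition fq_trace :: "nat \<Rightarrow> nat \<Rightarrow> 'a::field \<Rightarrow> 'a" where
  "fq_trace q n a = (\<Sum>i<n. a ^ (q ^ i))"

text \<open>Ordered bases are families indexed by \<open>{..<n}\<close>; values at other indices are irrelevant.\<close>

definition ordered_basis :: "('k::field \<Rightarrow> 'a::field) \<Rightarrow> nat \<Rightarrow> (nat \<Rightarrow> 'a) \<Rightarrow> bool" where
  "ordered_basis emb n \<xi> \<longleftrightarrow> inj_on \<xi> {..<n} \<and>
     \<not> module.dependent (scale_F emb) (\<xi> ` {..<n}) \<and>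
     module.span (scale_F emb) (\<xi> ` {..<n}) = UNIV"

definition dual_bases ::
  "('k::field \<Rightarrow> 'a::field) \<Rightarrow> nat \<Rightarrow> (nat \<Rightarrow> 'a) \<Rightarrow> (nat \<Rightarrow> 'a) \<Rightarrow> bool" where
  "dual_bases emb n \<xi> \<xi>' \<longleftrightarrow> ordered_basis emb n \<xi> \<and> ordered_basis emb n \<xi>' \<and>
     (\<forall>i<n. \<forall>j<n. fq_trace CARD('k) n (\<xi> i * \<xi>' j) = (if i = j then 1 else 0))"

end

theory Submission
  imports Defs "HOL-Computational_Algebra.Polynomial"
begin

text \<open>
  Write \<open>P = \<langle>p\<rangle>\<close> and \<open>Q = \<langle>w\<rangle>\<close>. Since \<open>t + s = n\<close>, the subspace \<open>U\<close> consists of the vectors \<open>a p + b w\<close> with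
  \<open>a \<in> T\<close> and \<open>b \<in> S\<close>, where \<open>T\<close> and \<open>S\<close> are the coordinate subspaces of \<open>U \<inter> P\<close> and \<open>U \<inter> Q\<close>.
  Rescaling \<open>w\<close> replaces \<open>S\<close> by a multiple of itself; as \<open>(q^t - 1)(q^s - 1) < q^n - 1\<close>, some
  multiple meets \<open>T\<close> trivially, and then \<open>T \<oplus> S\<close> is the whole field. The matrix that sends
  \<open>(1,0)\<close> to \<open>p\<close> and \<open>(1,1)\<close> to \<open>w\<close> maps the graph \<open>{(v + u, u)}\<close> of the projection onto \<open>U\<close>.
  The trace formula reads off the coordinates of \<open>x\<close> in the basis \<open>\<xi>\<close> by pairing with the dual basis.
\<close>

section \<open>Counting subspaces, sums and scalings\<close>

text \<open>Adjoining \<open>b\<close> outside \<open>span B\<close> multiplies the size by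
  \<open>CARD('k)\<close>, through the bijection \<open>(c, x) \<mapsto> scale c b + x\<close>.
  Dimension arguments thereby become counting arguments.\<close>

lemma card_subspace:
  fixes scale :: "'k::{field,finite} \<Rightarrow> 'b::{ab_group_add,finite} \<Rightarrow> 'b"
  assumes "vector_space scale" and W: "module.subspace scale W"
  shows "card W = CARD('k) ^ vector_space.dim scale W"
proof -
  interpret vector_space scale by fact
  have card_span: "card (span B) = CARD('k) ^ card B" if "independent B" for B
    using finite[of B] that
  proof (induction B rule: finite_induct)
    case empty
    then show ?case by simp
  next
    case (insert b B)
    then have ind: "independent B" and b: "b \<notin> span B"
      by (auto simp: independent_insert)
    define g where "g = (\<lambda>(c, x). scale c b + x)"
    have "inj_on g (UNIV \<times> span B)"
    proof (rule inj_onI, clarsimp simp: g_def)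
      fix c x d y
      assume x: "x \<in> span B" and y: "y \<in> span B" and eq: "scale c b + x = scale d b + y"
      have diff: "scale (c - d) b = y - x"
        using eq by (simp add: scale_left_diff_distrib algebra_simps)
      then have "scale (c - d) b \<in> span B"
        using x y by (simp add: span_diff)
      \<comment> \<open>If \<open>c \<noteq> d\<close>, this scaling recovers \<open>b\<close>
        itself, against \<open>b \<notin> span B\<close>.\<close>
      then have "scale (inverse (c - d)) (scale (c - d) b) \<in> span B"
        by (rule span_scale)
      then have "c = d"
        using b by (cases "c = d") auto
      then show "c = d \<and> x = y"
        using eq by simp
    qed
    moreover have "g ` (UNIV \<times> span B) = span (insert b B)"
    proof (intro subset_antisym subsetI)
      fix z assume "z \<in> span (insert b B)"
      then obtain k where "z - scale k b \<in> span B"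
        by (auto simp: span_breakdown_eq)
      then show "z \<in> g ` (UNIV \<times> span B)"
        by (intro image_eqI[where x = "(k, z - scale k b)"]) (auto simp: g_def)
    next
      fix z assume "z \<in> g ` (UNIV \<times> span B)"
      then obtain k x where "x \<in> span B" "z = scale k b + x"
        by (auto simp: g_def)
      then show "z \<in> span (insert b B)"
        unfolding span_breakdown_eq by (intro exI[where x = k]) simp
    qed
    ultimately have "card (span (insert b B)) = card ((UNIV :: 'k set) \<times> span B)"
      by (metis card_image)
    then show ?case
      using insert ind by (simp add: card_cartesian_product)
  qed
  obtain B where B: "B \<subseteq> W" "independent B" "W \<subseteq> span B" "card B = dim W"
    using basis_exists by blast
  then have "span B = W"
    using W by (simp add: span_subspace)
  then show ?thesis
    using card_span[OF B(2)] B(4) by simp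
qed

text \<open>Two representations of the same sum differ by an element of \<open>A \<inter> B\<close>.
  Only closure under differences is asked for, so that the lemma serves in the field as well as in
  the plane.\<close>

lemma card_sum_set:
  fixes A B :: "'b::ab_group_add set"
  assumes "\<And>x y. x \<in> A \<Longrightarrow> y \<in> A \<Longrightarrow> x - y \<in> A" "\<And>x y. x \<in> B \<Longrightarrow> y \<in> B \<Longrightarrow> x - y \<in> B"
    and "A \<inter> B \<subseteq> {0}"
  shows "card {a + b | a b. a \<in> A \<and> b \<in> B} = card A * card B"
proof -
  have "inj_on (\<lambda>(a, b). a + b) (A \<times> B)"
  proof (rule inj_onI, clarsimp)
    fix a b c d
    assume *: "a \<in> A" "b \<in> B" "c \<in> A" "d \<in> B" "a + b = c + d"
    then have eq: "a - c = d - b"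
      by (simp add: algebra_simps)
    have "a - c \<in> A \<inter> B"
      using assms(1)[OF *(1,3)] assms(2)[OF *(4,2)] eq by simp
    then have "a - c = 0"
      using assms(3) by blast
    then show "a = c \<and> b = d"
      using *(5) by simp
  qed
  moreover have "{a + b | a b. a \<in> A \<and> b \<in> B} = (\<lambda>(a, b). a + b) ` (A \<times> B)"
    by auto
  ultimately show ?thesis
    by (simp add: card_image card_cartesian_product)
qed

text \<open>A scalar \<open>m \<noteq> 0\<close> is bad only if it is a quotient
  \<open>a / b\<close> of nonzero elements of \<open>A\<close> and \<open>B\<close>. By the bound
  there are fewer quotients than nonzero scalars.\<close>

lemma exists_scaling_disjoint:
  fixes A B :: "'a::{field,finite} set"
  assumes "(card (A - {0})) * (card (B - {0})) < CARD('a) - 1"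
  obtains m where "m \<noteq> 0" "\<And>b. b \<in> B \<Longrightarrow> m * b \<in> A \<Longrightarrow> b = 0"
proof -
  let ?R = "(\<lambda>(a, b). a / b) ` ((A - {0}) \<times> (B - {0}))"
  have "card ?R \<le> card ((A - {0}) \<times> (B - {0}))"
    by (rule card_image_le) simp
  also have "\<dots> < card (UNIV - {0 :: 'a})"
    using assms by (simp add: card_cartesian_product card_Diff_subset)
  finally have "\<not> UNIV - {0} \<subseteq> ?R"
    using card_mono[of ?R "UNIV - {0}"] by (metis finite leD)
  then obtain m where m: "m \<noteq> 0" "m \<notin> ?R"
    by blast
  have "b = 0" if "b \<in> B" "m * b \<in> A" for b
  proof (rule ccontr)
    assume "b \<noteq> 0"
    then have "m \<in> ?R"
      using m(1) that by (intro image_eqI[where x = "(m * b, b)"]) auto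
    with m(2) show False ..
  qed
  with m(1) show thesis
    using that by blast
qed

section \<open>Projections, projectivities and points\<close>

text \<open>Two candidates for the \<open>S\<close>-part of \<open>x\<close> differ by an element of
  \<open>T \<inter> S\<close>, so the definite description is well defined.\<close>

lemma projection_eqI:
  assumes "direct_sum_decomposition emb T S" "field_embedding emb"
    and "u \<in> S" "v \<in> T" "x = u + v"
  shows "projection T S x = u"
  unfolding projection_def
proof (rule the_equality)
  interpret vector_space "scale_F emb"
    using assms(2) by (rule vector_space_scale_F)
  show "u \<in> S \<and> (\<exists>v\<in>T. x = u + v)"
    using assms by blast
  fix u' assume "u' \<in> S \<and> (\<exists>v\<in>T. x = u' + v)"
  then obtain v' where u': "u' \<in> S" "v' \<in> T" "x = u' + v'"
    by blast
  have "u' - u = v - v'"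
    using u' assms(5) by (simp add: algebra_simps)
  moreover have "u' - u \<in> S" "v - v' \<in> T"
    using assms u' by (auto simp: direct_sum_decomposition_def intro: subspace_diff)
  ultimately have "u' - u \<in> T \<inter> S"
    by simp
  then have "u' - u \<in> {0}"
    using assms(1) by (metis direct_sum_decomposition_def)
  then show "u' = u"
    by simp
qed

lemma projectivity_span_singleton: "projectivity A (vec.span {v}) = vec.span {A *v v}"
  by (auto simp: projectivity_def vec.span_singleton vector_scalar_commute image_image)

text \<open>\<open>M\<close> carries the graph of \<open>f\<close> onto \<open>U\<close>, so its
  inverse gives the projectivity from \<open>linear_set U\<close>. By \<open>f 0 = 0\<close> and
  injectivity of \<open>M\<close>, the zero vector of \<open>U\<close> arises exactly from
  \<open>x = 0\<close>, the argument that \<open>linear_set_of_map\<close> leaves out.\<close>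

lemma pgl_equivalent_linear_set_of_map:
  fixes M :: "'a::field^2^2"
  assumes "invertible M" "f 0 = 0" and U: "U = range (\<lambda>x. M *v vector [x, f x])"
  shows "pgl_equivalent (linear_set U) (linear_set_of_map f)"
proof -
  obtain A where A: "A ** M = mat 1" "M ** A = mat 1"
    using assms(1) by (auto simp: invertible_def)
  have AM: "A *v (M *v v) = v" for v
    by (simp add: matrix_vector_mul_assoc A)
  have nz: "M *v vector [x, f x] \<noteq> 0 \<longleftrightarrow> x \<noteq> 0" for x
  proof -
    have "M *v vector [x, f x] = 0 \<longleftrightarrow> vector [x, f x] = (0 :: 'a^2)"
      by (metis AM matrix_vector_mult_0_right)
    also have "\<dots> \<longleftrightarrow> x = 0"
      using assms(2) by (auto simp: vec_eq_iff forall_2)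
    finally show ?thesis by simp
  qed
  have "linear_set U = (\<lambda>x. vec.span {M *v vector [x, f x]}) ` {x. x \<noteq> 0}"
    unfolding linear_set_def U using nz by blast
  then have "projectivity A ` linear_set U = linear_set_of_map f"
    by (auto simp: linear_set_of_map_def image_image projectivity_span_singleton AM)
  then show ?thesis
    using A unfolding pgl_equivalent_def invertible_def by blast
qed

text \<open>If \<open>b \<noteq> 0\<close>, then \<open>w\<close> is a nonzero multiple of
  \<open>p\<close> and the two points coincide.\<close>

lemma distinct_points_independent:
  fixes p w :: "'a::field^2"
  assumes "p \<noteq> 0" "w \<noteq> 0" "vec.span {p} \<noteq> vec.span {w}" "a *s p + b *s w = 0"
  shows "a = 0 \<and> b = 0"
proof -
  have "b = 0"
  proof (rule ccontr)
    assume "b \<noteq> 0"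
    have "b *s w = (- a) *s p"
      using assms(4) by (metis add.commute eq_neg_iff_add_eq_0 vec.scale_minus_left)
    then have "inverse b *s (b *s w) = inverse b *s ((- a) *s p)"
      by simp
    then have w: "w = (- a / b) *s p"
      using \<open>b \<noteq> 0\<close> by (simp add: vector_smult_assoc field_simps)
    then have "- a / b \<noteq> 0"
      using assms(2) by auto
    then have "vec.span {(- a / b) *s p} = vec.span {p}"
      using vec.span_image_scale[of "{p}" "\<lambda>_. - a / b"] by simp
    then show False
      using w assms(3) by simp
  qed
  then show ?thesis
    using assms by simp
qed

lemma matrix_of_two_points:
  fixes p w :: "'a::field^2"
  assumes "\<And>a b. a *s p + b *s w = 0 \<Longrightarrow> a = 0 \<and> b = 0"
  shows "\<exists>M :: 'a^2^2. invertible M \<and> (\<forall>x y. M *v vector [x, y] = (x - y) *s p + y *s w)"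
proof -
  \<comment> \<open>The columns are the images of the unit vectors: \<open>p\<close>, and
    \<open>w - p\<close> because \<open>(1,1)\<close> has to go to \<open>w\<close>.\<close>
  define M :: "'a^2^2" where "M = (\<chi> i j. if j = 1 then p $ i else w $ i - p $ i)"
  have M: "M *v v = (v $ 1 - v $ 2) *s p + v $ 2 *s w" for v
    by (simp add: M_def vec_eq_iff matrix_vector_mult_def sum_2 algebra_simps)
  have "v = 0" if "M *v v = 0" for v
    using assms[of "v $ 1 - v $ 2" "v $ 2"] that by (auto simp: M vec_eq_iff forall_2)
  then have "invertible M"
    by (auto simp: invertible_left_inverse matrix_left_invertible_ker)
  then show ?thesis
    using M by (intro exI[of _ M]) simp
qed

section \<open>Construction of the equivalent linear set\<close>

lemma subspace_coordinates:
  assumes "field_embedding emb" "module.subspace (scale_V emb) U"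
  shows "module.subspace (scale_F emb) {a. a *s p \<in> U}"
proof -
  interpret F: vector_space "scale_F emb"
    using assms(1) by (rule vector_space_scale_F)
  interpret V: vector_space "scale_V emb"
    using assms(1) by (rule vector_space_scale_V)
  show ?thesis
  proof (rule F.subspaceI)
    show "0 \<in> {a. a *s p \<in> U}"
      using V.subspace_0[OF assms(2)] by simp
    show "a + b \<in> {a. a *s p \<in> U}" if "a \<in> {a. a *s p \<in> U}" "b \<in> {a. a *s p \<in> U}" for a b
      using that V.subspace_add[OF assms(2)] by (simp add: vector_sadd_rdistrib)
    show "emb c * a \<in> {a. a *s p \<in> U}" if "a \<in> {a. a *s p \<in> U}" for c a
      using that V.subspace_scale[OF assms(2), of "a *s p" c] by (simp add: vector_smult_assoc)
  qed
qed

lemma card_coordinates: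
  fixes p :: "'a::field^2"
  assumes "p \<noteq> 0"
  shows "card {a. a *s p \<in> U} = card (U \<inter> vec.span {p})"
proof (rule bij_betw_same_card)
  show "bij_betw (\<lambda>a. a *s p) {a. a *s p \<in> U} (U \<inter> vec.span {p})"
    using assms by (auto simp: bij_betw_def inj_on_def vec.span_singleton)
qed

lemma linear_set_equivalent_projection:
  fixes emb :: "'k::{field,finite} \<Rightarrow> 'a::{field,finite}" and U P Q :: "('a^2) set"
  assumes emb: "field_embedding emb" and card_a: "CARD('a) = CARD('k) ^ n" and n: "n \<ge> 1"
    and U: "module.subspace (scale_V emb) U" "vector_space.dim (scale_V emb) U = n"
    and PQ: "P \<in> pg_points" "Q \<in> pg_points" "Q \<noteq> P"
    and wt: "weight emb U P = t" "weight emb U Q = s" "t + s = n"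
  obtains T S where "direct_sum_decomposition emb T S"
    "vector_space.dim (scale_F emb) T = t" "vector_space.dim (scale_F emb) S = s"
    "pgl_equivalent (linear_set U) (linear_set_of_map (projection T S))"
proof -
  let ?q = "CARD('k)"
  interpret F: vector_space "scale_F emb"
    using emb by (rule vector_space_scale_F)
  interpret V: vector_space "scale_V emb"
    using emb by (rule vector_space_scale_V)
  have q: "?q > 1"
    using card_mono[of UNIV "{0 :: 'k, 1}"] by simp
  have prod: "?q ^ n = ?q ^ t * ?q ^ s"
    using wt(3) by (simp flip: power_add)
  have card_point: "card {a. a *s v \<in> U} = ?q ^ weight emb U (vec.span {v})" if "v \<noteq> 0" for v
  proof -
    \<comment> \<open>A point is closed under all scalars of \<open>'a\<close>, in particular under
      those of the form \<open>emb c\<close>.\<close>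
    have "V.subspace (vec.span {v})"
      unfolding V.subspace_def
      by (auto intro: vec.span_zero vec.span_add vec.span_scale)
    then have "V.subspace (U \<inter> vec.span {v})"
      using U(1) by (rule V.subspace_inter[rotated])
    then show ?thesis
      using card_subspace[OF V.vector_space_axioms] card_coordinates[OF that]
      by (simp add: weight_def)
  qed
  obtain p where p: "P = vec.span {p}" "p \<noteq> 0"
    using PQ(1) by (auto simp: pg_points_def)
  obtain w0 where w0: "Q = vec.span {w0}" "w0 \<noteq> 0"
    using PQ(2) by (auto simp: pg_points_def)
  define T where "T = {a. a *s p \<in> U}"
  define S0 where "S0 = {a. a *s w0 \<in> U}"
  have T: "F.subspace T" and S0: "F.subspace S0"
    unfolding T_def S0_def using subspace_coordinates[OF emb U(1)] by blast+
  have cards: "card T = ?q ^ t" "card S0 = ?q ^ s"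
    using card_point p w0 wt by (simp_all add: T_def S0_def)
  have "(card (T - {0})) * (card (S0 - {0})) < CARD('a) - 1"
  proof -
    \<comment> \<open>With these names no truncated subtraction occurs in the factors: the claim is
      \<open>i * j < Suc i * Suc j - 1 = i * j + i + j\<close>. It fails only for
      \<open>i = j = 0\<close>, which would mean \<open>q^n = 1\<close>.\<close>
    obtain i j where ij: "?q ^ t = Suc i" "?q ^ s = Suc j"
      using q by (metis not0_implies_Suc power_not_zero zero_less_one not_less_zero)
    have "?q ^ n \<ge> ?q ^ 1"
      using q n by (intro power_increasing) auto
    then have "i \<noteq> 0 \<or> j \<noteq> 0"
      using q ij prod by (cases i; cases j) auto
    then have "i * j < Suc i * Suc j - 1"
      by auto
    moreover have "card (T - {0}) = i" "card (S0 - {0}) = j"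
      using ij cards F.subspace_0[OF T] F.subspace_0[OF S0] by (simp_all add: card_Diff_singleton)
    ultimately show ?thesis
      using card_a prod ij by simp
  qed
  then obtain m where m: "m \<noteq> 0" "\<And>b. b \<in> S0 \<Longrightarrow> m * b \<in> T \<Longrightarrow> b = 0"
    using exists_scaling_disjoint by blast
  \<comment> \<open>With this generator of \<open>Q\<close> the coordinate set \<open>S\<close>
    below is \<open>m\<close> times \<open>S0\<close>, so the choice of \<open>m\<close> yields
    \<open>T \<inter> S = {0}\<close>.\<close>
  define w where "w = inverse m *s w0"
  have w: "w \<noteq> 0" "Q = vec.span {w}"
    using m(1) w0 vec.span_image_scale[of "{w0}" "\<lambda>_. inverse m"] by (auto simp: w_def)
  define S where "S = {a. a *s w \<in> U}"
  have S: "F.subspace S"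
    unfolding S_def using subspace_coordinates[OF emb U(1)] .
  have card_S: "card S = ?q ^ s"
    using card_point w wt by (simp add: S_def)
  have TS: "T \<inter> S = {0}"
  proof -
    have "b = 0" if "b \<in> T" "b \<in> S" for b
      using m(2)[of "b / m"] that m(1) by (auto simp: S_def S0_def w_def vector_smult_assoc field_simps)
    then show ?thesis
      using F.subspace_0[OF T] F.subspace_0[OF S] by blast
  qed
  \<comment> \<open>The sum is direct and has \<open>q^t * q^s = q^n\<close> elements, so it
    exhausts the field.\<close>
  have "card {v + u | v u. v \<in> T \<and> u \<in> S} = CARD('a)"
    using card_sum_set[of T S] TS F.subspace_diff[OF T] F.subspace_diff[OF S] cards card_S card_a prod
    by simp
  then have "{v + u | v u. v \<in> T \<and> u \<in> S} = UNIV"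
    by (intro card_subset_eq) auto
  with T S TS have decomp: "direct_sum_decomposition emb T S"
    by (simp add: direct_sum_decomposition_def)
  have dims: "F.dim T = t" "F.dim S = s"
    using card_subspace[OF F.vector_space_axioms T] card_subspace[OF F.vector_space_axioms S]
      cards card_S q by (simp_all add: power_inject_exp)
  have indep: "a = 0 \<and> b = 0" if "a *s p + b *s w = 0" for a b
    using distinct_points_independent[OF p(2) w(1) _ that] PQ(3) p(1) w(2) by auto
  have "\<exists>M :: 'a^2^2. invertible M \<and> (\<forall>x y. M *v vector [x, y] = (x - y) *s p + y *s w)"
    by (rule matrix_of_two_points) (rule indep)
  then obtain M :: "'a^2^2" where
    M: "invertible M" "\<forall>x y. M *v vector [x, y] = (x - y) *s p + y *s w"
    by blast
  \<comment> \<open>\<open>Tp\<close> and \<open>Sw\<close> are \<open>U \<inter> P\<close> and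
    \<open>U \<inter> Q\<close>. Their sum lies in \<open>U\<close>, and comparing cardinalities
    shows that it is all of \<open>U\<close>.\<close>
  define Tp where "Tp = (\<lambda>a. a *s p) ` T"
  define Sw where "Sw = (\<lambda>a. a *s w) ` S"
  let ?TS = "{v + u | v u. v \<in> Tp \<and> u \<in> Sw}"
  have "card ?TS = card Tp * card Sw"
  proof (rule card_sum_set)
    show "x - y \<in> Tp" if xy: "x \<in> Tp" "y \<in> Tp" for x y
    proof -
      obtain a b where ab: "a \<in> T" "b \<in> T" "x = a *s p" "y = b *s p"
        using xy unfolding Tp_def by blast
      then have "x - y = (a - b) *s p"
        by (simp only: vec.scale_left_diff_distrib)
      then show ?thesis
        unfolding Tp_def using F.subspace_diff[OF T ab(1,2)] by blast
    qed
    show "x - y \<in> Sw" if xy: "x \<in> Sw" "y \<in> Sw" for x y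
    proof -
      obtain a b where ab: "a \<in> S" "b \<in> S" "x = a *s w" "y = b *s w"
        using xy unfolding Sw_def by blast
      then have "x - y = (a - b) *s w"
        by (simp only: vec.scale_left_diff_distrib)
      then show ?thesis
        unfolding Sw_def using F.subspace_diff[OF S ab(1,2)] by blast
    qed
    have "a = 0 \<and> b = 0" if "a *s p = b *s w" for a b
      using indep[of a "- b"] that by simp
    then show "Tp \<inter> Sw \<subseteq> {0}"
      unfolding Tp_def Sw_def by fastforce
  qed
  also have "\<dots> = card T * card S"
    using p(2) w(1) by (simp add: Tp_def Sw_def card_image inj_on_def)
  also have "\<dots> = card U"
    using card_subspace[OF V.vector_space_axioms U(1)] U(2) cards card_S prod
    by simp
  finally have "?TS = U"
    by (intro card_subset_eq) (auto simp: Tp_def Sw_def T_def S_def intro: V.subspace_add[OF U(1)])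
  \<comment> \<open>For \<open>x = v + u\<close> with \<open>v \<in> T\<close> and
    \<open>u \<in> S\<close> the projection is \<open>u\<close>, and \<open>M\<close> sends
    \<open>(v + u, u)\<close> to \<open>v *s p + u *s w\<close>.\<close>
  moreover have "range (\<lambda>x. M *v vector [x, projection T S x]) = ?TS"
  proof (intro subset_antisym subsetI)
    fix y assume "y \<in> range (\<lambda>x. M *v vector [x, projection T S x])"
    then obtain x where y: "y = M *v vector [x, projection T S x]"
      by blast
    have "x \<in> {v + u | v u. v \<in> T \<and> u \<in> S}"
      using decomp by (simp add: direct_sum_decomposition_def)
    then obtain v u where "x = v + u" and vu: "v \<in> T" "u \<in> S"
      by blast
    then have x: "x = u + v"
      by (simp only: add.commute)
    have "projection T S x = u"
      using projection_eqI[OF decomp emb vu(2,1) x] .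
    then have "y = v *s p + u *s w"
      using y x by (simp add: M(2))
    then show "y \<in> ?TS"
      using vu by (auto simp: Tp_def Sw_def)
  next
    fix y assume "y \<in> ?TS"
    then obtain v u where vu: "y = v *s p + u *s w" "v \<in> T" "u \<in> S"
      by (auto simp: Tp_def Sw_def)
    have "projection T S (u + v) = u"
      using projection_eqI[OF decomp emb vu(3,2) refl] .
    then have "y = M *v vector [u + v, projection T S (u + v)]"
      using vu(1) by (simp add: M(2))
    then show "y \<in> range (\<lambda>x. M *v vector [x, projection T S x])"
      by blast
  qed
  moreover have "projection T S 0 = 0"
    using projection_eqI[OF decomp emb F.subspace_0[OF S] F.subspace_0[OF T]] by simp
  ultimately have "pgl_equivalent (linear_set U) (linear_set_of_map (projection T S))"
    by (intro pgl_equivalent_linear_set_of_map[OF M(1)]) auto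
  with decomp dims show thesis
    using that by blast
qed

section \<open>The Frobenius map and the trace\<close>

text \<open>Multiplication by \<open>c \<noteq> 0\<close> permutes the nonzero elements. Cancelling
  their product leaves \<open>c\<close> to the power \<open>CARD('k) - 1\<close> equal to
  \<open>1\<close>.\<close>

lemma power_CARD_eq_same:
  fixes c :: "'k::{field,finite}"
  shows "c ^ CARD('k) = c"
proof (cases "c = 0")
  case True
  then show ?thesis by (simp add: power_0_left)
next
  case False
  let ?N = "UNIV - {0 :: 'k}"
  have "bij_betw (\<lambda>x. c * x) ?N ?N"
    by (rule bij_betwI[where g = "\<lambda>x. x / c"]) (use False in auto)
  then have "(\<Prod>x\<in>?N. c * x) = (\<Prod>x\<in>?N. x)"
    by (rule prod.reindex_bij_betw)
  then have "c ^ card ?N * (\<Prod>x\<in>?N. x) = (\<Prod>x\<in>?N. x)"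
    by (simp add: prod.distrib)
  moreover have "(\<Prod>x\<in>?N. x) \<noteq> 0"
    by simp
  ultimately have "c ^ card ?N = 1"
    by simp
  moreover have "CARD('k) = Suc (card ?N)"
    by (rule card.remove) simp_all
  ultimately show ?thesis
    by (metis mult.right_neutral power_Suc)
qed

text \<open>Over the small field, \<open>(X + 1)^q\<close> and \<open>X^q + 1\<close> take the same \<open>q\<close> values; both are monic of
  degree \<open>q\<close>, so they coincide as polynomials.\<close>

lemma add_power_CARD:
  fixes emb :: "'k::{field,finite} \<Rightarrow> 'a::field"
  assumes "field_embedding emb"
  shows "(x + y) ^ CARD('k) = x ^ CARD('k) + (y :: 'a) ^ CARD('k)"
proof -
  let ?q = "CARD('k)"
  have hom: "emb (a + b) = emb a + emb b" "emb (a * b) = emb a * emb b" "emb 1 = 1" for a b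
    using assms by (auto simp: field_embedding_def)
  have emb_power: "emb c ^ i = emb (c ^ i)" for c i
    by (induction i) (simp_all add: hom)
  have emb_0: "emb 0 = 0"
    using hom(1)[of 0 0] by (metis add.right_neutral add_left_cancel)
  have "emb a \<noteq> 0" if "a \<noteq> 0" for a
    using hom(2)[of a "inverse a"] that hom(3) by auto
  moreover have "emb (a - b) = emb a - emb b" for a b
    using hom(1)[of "a - b" b] by simp
  ultimately have "inj emb"
    by (metis eq_iff_diff_eq_0 injI)
  have q: "?q > 0"
    by simp
  have eq: "[:1, 1:] ^ ?q = monom 1 ?q + (1 :: 'a poly)"
  proof (rule poly_eqI_degree_lead_coeff[where A = "range emb" and n = ?q])
    have "coeff ([:1, 1 :: 'a:] ^ ?q) (degree ([:1, 1 :: 'a:] ^ ?q)) = 1"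
      by (subst lead_coeff_power) simp
    then show "coeff ([:1, 1 :: 'a:] ^ ?q) ?q = coeff (monom 1 ?q + 1) ?q"
      by (simp add: degree_power_eq)
    show "?q \<le> card (range emb)"
      using \<open>inj emb\<close> by (simp add: card_image)
    show "degree ([:1, 1 :: 'a:] ^ ?q) \<le> ?q"
      by (simp add: degree_power_eq)
    show "degree (monom 1 ?q + (1 :: 'a poly)) \<le> ?q"
      by (intro degree_add_le) (simp_all add: degree_monom_le)
    fix z assume "z \<in> range emb"
    then obtain c where c: "z = emb c"
      by blast
    have "(1 + emb c) ^ ?q = emb ((1 + c) ^ ?q)"
      by (simp add: hom flip: emb_power)
    also have "\<dots> = emb (c ^ ?q) + 1"
      by (simp add: power_CARD_eq_same hom)
    finally show "poly ([:1, 1:] ^ ?q) z = poly (monom 1 ?q + 1) z"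
      by (simp add: c poly_monom flip: emb_power)
  qed
  \<comment> \<open>Evaluation extends the identity from the image of the small field to every
    element of \<open>'a\<close>; the general sum then follows by factoring out
    \<open>x\<close>.\<close>
  have one: "(1 + z) ^ ?q = z ^ ?q + 1" for z :: 'a
    using arg_cong[OF eq, of "\<lambda>r. poly r z"] by (simp add: poly_monom)
  show ?thesis
  proof (cases "x = 0")
    case True
    then show ?thesis by (simp add: power_0_left)
  next
    case False
    then have "x * (1 + y / x) = x + y"
      by (simp add: distrib_left)
    then have "(x + y) ^ ?q = (x * (1 + y / x)) ^ ?q"
      by simp
    also have "\<dots> = x ^ ?q * ((y / x) ^ ?q + 1)"
      by (simp add: power_mult_distrib one)
    also have "\<dots> = x ^ ?q + y ^ ?q"
      using False by (simp add: power_divide field_simps)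
    finally show ?thesis .
  qed
qed

lemma fq_trace_add:
  fixes emb :: "'k::{field,finite} \<Rightarrow> 'a::field"
  assumes "field_embedding emb"
  shows "fq_trace CARD('k) n (x + y :: 'a) = fq_trace CARD('k) n x + fq_trace CARD('k) n y"
proof -
  have "(x + y) ^ (CARD('k) ^ i) = x ^ (CARD('k) ^ i) + y ^ (CARD('k) ^ i)" for i
    by (induction i) (simp_all add: add_power_CARD[OF assms] power_mult mult.commute[of "CARD('k)"])
  then show ?thesis
    by (simp add: fq_trace_def sum.distrib)
qed

text \<open>Elements of the embedded small field are fixed by every iterate of the
  \<open>q\<close>-power map, so they factor out of each summand.\<close>

lemma fq_trace_scale:
  fixes emb :: "'k::{field,finite} \<Rightarrow> 'a::field"
  assumes "field_embedding emb"
  shows "fq_trace CARD('k) n (emb c * x) = emb c * fq_trace CARD('k) n x"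
proof -
  have "emb c ^ j = emb (c ^ j)" for j
    using assms by (induction j) (simp_all add: field_embedding_def)
  then have "emb c ^ CARD('k) = emb c"
    by (simp add: power_CARD_eq_same)
  then have "emb c ^ (CARD('k) ^ i) = emb c" for i
    by (induction i) (simp_all add: power_mult)
  then show ?thesis
    by (simp add: fq_trace_def power_mult_distrib sum_distrib_left)
qed

lemma fq_trace_sum:
  fixes emb :: "'k::{field,finite} \<Rightarrow> 'a::field"
  assumes "field_embedding emb" "finite A"
  shows "fq_trace CARD('k) n (\<Sum>i\<in>A. f i :: 'a) = (\<Sum>i\<in>A. fq_trace CARD('k) n (f i))"
  using assms(2)
proof (induction A rule: finite_induct)
  case empty
  then show ?case
    by (simp add: fq_trace_def power_0_left)
next
  case (insert a A)
  then show ?case by (simp add: fq_trace_add[OF assms(1)])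
qed

section \<open>The projection in terms of dual bases\<close>

text \<open>By linearity of the trace and duality, the trace of \<open>\<xi>' j * x\<close> is the
  coordinate of \<open>x\<close> at \<open>\<xi> j\<close>, embedded in \<open>'a\<close>. The
  projection keeps the coordinates with index at least \<open>t\<close>.\<close>

lemma projection_eq_trace_sum:
  fixes emb :: "'k::{field,finite} \<Rightarrow> 'a::field"
  assumes emb: "field_embedding emb" and "t \<le> n"
    and decomp: "direct_sum_decomposition emb T S"
    and T: "T = module.span (scale_F emb) (\<xi> ` {..<t})"
    and S: "S = module.span (scale_F emb) (\<xi> ` {t..<n})"
    and dual: "dual_bases emb n \<xi> \<xi>'"
  shows "projection T S x = (\<Sum>i=t..<n. \<xi> i * fq_trace CARD('k) n (\<xi>' i * x))"
proof -
  interpret vector_space "scale_F emb"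
    using emb by (rule vector_space_scale_F)
  have inj: "inj_on \<xi> {..<n}" and sp: "span (\<xi> ` {..<n}) = UNIV"
    and tr: "\<And>i j. i < n \<Longrightarrow> j < n \<Longrightarrow> fq_trace CARD('k) n (\<xi> i * \<xi>' j) = (if i = j then 1 else 0)"
    using dual by (auto simp: dual_bases_def ordered_basis_def)
  have "x \<in> span (\<xi> ` {..<n})"
    using sp by simp
  then obtain r where "x = (\<Sum>v\<in>\<xi> ` {..<n}. emb (r v) * v)"
    by (auto simp: span_finite)
  then have x: "x = (\<Sum>i<n. emb (r (\<xi> i)) * \<xi> i)"
    using inj by (simp add: sum.reindex)
  have coord: "fq_trace CARD('k) n (\<xi>' j * x) = emb (r (\<xi> j))" if "j < n" for j
  proof -
    have "\<xi>' j * x = (\<Sum>i<n. emb (r (\<xi> i)) * (\<xi> i * \<xi>' j))"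
      by (subst x) (simp add: sum_distrib_left mult_ac)
    then have "fq_trace CARD('k) n (\<xi>' j * x) = (\<Sum>i<n. emb (r (\<xi> i)) * (if i = j then 1 else 0))"
      using that by (simp add: fq_trace_sum[OF emb] fq_trace_scale[OF emb] tr)
    then show ?thesis
      using that by (simp add: if_distrib[where f = "\<lambda>z. _ * z"] cong: if_cong)
  qed
  have "projection T S x = (\<Sum>i=t..<n. emb (r (\<xi> i)) * \<xi> i)"
  proof (rule projection_eqI[OF decomp emb])
    show "(\<Sum>i=t..<n. emb (r (\<xi> i)) * \<xi> i) \<in> S"
      unfolding S by (intro span_sum span_scale span_base) auto
    show "(\<Sum>i<t. emb (r (\<xi> i)) * \<xi> i) \<in> T"
      unfolding T by (intro span_sum span_scale span_base) auto
    show "x = (\<Sum>i=t..<n. emb (r (\<xi> i)) * \<xi> i) + (\<Sum>i<t. emb (r (\<xi> i)) * \<xi> i)"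
      using x sum.atLeastLessThan_concat[of 0 t n "\<lambda>i. emb (r (\<xi> i)) * \<xi> i"] \<open>t \<le> n\<close>
      by (simp add: lessThan_atLeast0 add.commute)
  qed
  also have "\<dots> = (\<Sum>i=t..<n. \<xi> i * fq_trace CARD('k) n (\<xi>' i * x))"
    by (intro sum.cong) (auto simp: coord mult.commute[of "emb _"])
  finally show ?thesis .
qed

lemma trace_sum_eq_polynomial:
  "(\<Sum>i\<in>A. a i * fq_trace q n (b i * x)) = (\<Sum>j<n. (\<Sum>i\<in>A. a i * b i ^ (q ^ j)) * x ^ (q ^ j))"
proof -
  have "(\<Sum>i\<in>A. a i * fq_trace q n (b i * x)) = (\<Sum>i\<in>A. \<Sum>j<n. a i * b i ^ (q ^ j) * x ^ (q ^ j))"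
    by (simp add: fq_trace_def sum_distrib_left power_mult_distrib mult.assoc)
  also have "\<dots> = (\<Sum>j<n. \<Sum>i\<in>A. a i * b i ^ (q ^ j) * x ^ (q ^ j))"
    by (rule sum.swap)
  finally show ?thesis
    by (simp add: sum_distrib_right)
qed

theorem theorem3p4:
  fixes emb :: "'k::{field,finite} \<Rightarrow> 'a::{field,finite}"
    and q n t s :: nat
    and U :: "('a^2) set" and L :: "('a^2) set set" and P Q :: "('a^2) set"
  assumes "field_embedding emb"
    and "CARD('k) = q" and "CARD('a) = q ^ n" and "n \<ge> 2"
    and "module.subspace (scale_V emb) U"
    and "vector_space.dim (scale_V emb) U = n"
    and "L = linear_set U"
    and "P \<in> pg_points" and "Q \<in> pg_points" and "Q \<noteq> P"
    and "weight emb U P = t" and "weight emb U Q = s" and "t + s = n"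
  shows "(\<exists>T S. direct_sum_decomposition emb T S \<and>
            vector_space.dim (scale_F emb) T = t \<and>
            vector_space.dim (scale_F emb) S = s \<and>
            pgl_equivalent L (linear_set_of_map (projection T S))) \<and>
         (\<forall>T S \<xi> \<xi>'. direct_sum_decomposition emb T S \<longrightarrow>
            vector_space.dim (scale_F emb) T = t \<longrightarrow>
            vector_space.dim (scale_F emb) S = s \<longrightarrow>
            T = module.span (scale_F emb) (\<xi> ` {..<t}) \<longrightarrow>
            S = module.span (scale_F emb) (\<xi> ` {t..<n}) \<longrightarrow>
            dual_bases emb n \<xi> \<xi>' \<longrightarrow>
            (\<forall>x. projection T S x = (\<Sum>i=t..<n. \<xi> i * fq_trace q n (\<xi>' i * x)) \<and>
                 (\<Sum>i=t..<n. \<xi> i * fq_trace q n (\<xi>' i * x)) =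
                 (\<Sum>j<n. (\<Sum>i=t..<n. \<xi> i * \<xi>' i ^ (q ^ j)) * x ^ (q ^ j))))"
proof (intro conjI allI impI)
  have card_a: "CARD('a) = CARD('k) ^ n" and n: "n \<ge> 1" and t: "t \<le> n"
    using assms by simp_all
  show "\<exists>T S. direct_sum_decomposition emb T S \<and>
            vector_space.dim (scale_F emb) T = t \<and>
            vector_space.dim (scale_F emb) S = s \<and>
            pgl_equivalent L (linear_set_of_map (projection T S))"
    using linear_set_equivalent_projection[OF assms(1) card_a n assms(5,6,8-13)] assms(7) by metis
  fix T S \<xi> \<xi>' x
  assume "direct_sum_decomposition emb T S"
    "T = module.span (scale_F emb) (\<xi> ` {..<t})" "S = module.span (scale_F emb) (\<xi> ` {t..<n})"
    "dual_bases emb n \<xi> \<xi>'"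
  then show "projection T S x = (\<Sum>i=t..<n. \<xi> i * fq_trace q n (\<xi>' i * x))"
    using projection_eq_trace_sum[OF assms(1) t] assms(2) by blast
  show "(\<Sum>i=t..<n. \<xi> i * fq_trace q n (\<xi>' i * x)) =
      (\<Sum>j<n. (\<Sum>i=t..<n. \<xi> i * \<xi>' i ^ (q ^ j)) * x ^ (q ^ j))"
    by (rule trace_sum_eq_polynomial)
qed

end
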